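(* Let $\langle F,R,\langle\mathcal V,\mathcal E\rangle\rangle$ be a linear co-design problem (LCDP). Then the system-level design problem obtained by composing the component design problems along the multigraph $\langle\mathcal V,\mathcal E\rangle$ is a linear design problem from $F$ to $R$. In particular, its feasible set $\mathrm{ldp}_{\mathrm{tot}}\subseteq F\times R$ is a polyhedron.
   Context: A Euclidean sub-poset is a subset of some $\mathbb{R}^n_{\ge 0}$ with the restricted componentwise order $\preceq$. For posets $F,R$, a design problem (DP) from $F$ (functionalities) to $R$ (resources) is an upper set of $F^{\mathrm{op}}\times R$, i.e. a set of feasible pairs $\langle x_F,x_R\rangle$ closed under decreasing $x_F$ in $F$ and increasing $x_R$ in $R$. A linear design problem (LDP) is a DP between Euclidean sub-posets whose set of feasible pairs is a polyhedron (finite intersection of closed halfspaces) in the underlying Euclidean space. A linear co-design problem (LCDP) $\langle F,R,\langle\mathcal V,\mathcal E\rangle\rangle$ consists of a finite multigraph such that: (i) each node $d\in\mathcal V$ is an LDP with feasible set $\mathrm{ldp}_d\subseteq F_d\times R_d$, where $F_d=\prod_i F_{d,i}$ and $R_d=\prod_j R_{d,j}$ are finite products of Euclidean sub-posets (the factors are the functionality and resource ports of $d$); (ii) each edge $e\in\mathcal E$ is a pair $\langle\langle d_1,i_1\rangle,\langle d_2,j_2\rangle\rangle$ linking the $i_1$-th resource port of $d_1$ to the $j_2$-th functionality port of $d_2$, where $R_{d_1,i_1}=F_{d_2,j_2}$ as posets, and it represents the constraint $x_{R_{d_1,i_1}}\preceq x_{F_{d_2,j_2}}$ (the resource required by $d_1$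 is at most the functionality provided by $d_2$); (iii) the system-level functionality space $F$ (resource space $R$) is the product of all functionality (resource) ports not belonging to any edge. The system-level design problem obtained by composition has feasible set $\mathrm{ldp}_{\mathrm{tot}}$ equal to the set of $\langle x_F,x_R\rangle\in F\times R$ for which there is an assignment of values to all ports of all nodes that extends $\langle x_F,x_R\rangle$ on the unconnected ports, lies in $\mathrm{ldp}_d$ for every $d\in\mathcal V$, and satisfies the inequality of every edge. *)

theory Defs
  imports "HOL-Analysis.Analysis"
begin

text \<open>
  The dimensions of the ports, and the number of ports, vary with the node, so Euclidean spaces are
  given by finite index sets instead of types: \<open>\<real>\<^sup>I\<close> is the set of extensional functions
  \<open>I \<rightarrow>\<^sub>E UNIV\<close>, and \<open>\<real>\<^sup>n\<close> is the case \<open>I = {..<n}\<close>.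
  Extensional functions agree outside of \<open>I\<close>, so the library order \<open>\<le>\<close> on functions is the
  componentwise order of \<open>\<real>\<^sup>I\<close> (see \<open>euclid_le_iff\<close>).
\<close>

definition euclid :: "'i set \<Rightarrow> ('i \<Rightarrow> real) set" where
  "euclid I = (I \<rightarrow>\<^sub>E UNIV)"

definition euclid_subposet :: "'i set \<Rightarrow> ('i \<Rightarrow> real) set \<Rightarrow> bool" where
  "euclid_subposet I P \<longleftrightarrow> finite I \<and> P \<subseteq> {x \<in> euclid I. \<forall>i\<in>I. 0 \<le> x i}"

lemma euclid_le_iff:
  assumes "x \<in> euclid I" "y \<in> euclid I"
  shows "x \<le> y \<longleftrightarrow> (\<forall>i\<in>I. x i \<le> y i)"
proof -
  have "x i = y i" if "i \<notin> I" for i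
    using assms that by (simp add: euclid_def PiE_def extensional_def)
  then show ?thesis
    by (metis le_fun_def order_refl)
qed

text \<open>
  The normal vector \<open>a\<close> of a halfspace may be zero here. This matters only in dimension 0, where
  the empty set would otherwise not be a polyhedron; in positive dimension the notion agrees
  with \<open>polyhedron\<close> (lemma \<open>polyhedron_in_UNIV_iff\<close>).
\<close>

definition halfspace_in :: "'i set \<Rightarrow> ('i \<Rightarrow> real) set \<Rightarrow> bool" where
  "halfspace_in I h \<longleftrightarrow> (\<exists>a b. h = {x \<in> euclid I. (\<Sum>i\<in>I. a i * x i) \<le> b})"

definition polyhedron_in :: "'i set \<Rightarrow> ('i \<Rightarrow> real) set \<Rightarrow> bool" where
  "polyhedron_in I S \<longleftrightarrow>
     (\<exists>H. finite H \<and> (\<forall>h\<in>H. halfspace_in I h) \<and> S = euclid I \<inter> \<Inter>H)"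

lemma polyhedron_in_UNIV_iff:
  fixes S :: "('n::finite \<Rightarrow> real) set"
  shows "polyhedron_in UNIV S \<longleftrightarrow> polyhedron (vec_lambda ` S)"
proof -
  have half: "vec_lambda ` {x \<in> euclid (UNIV :: 'n set). (\<Sum>i\<in>UNIV. a i * x i) \<le> b} =
      {y. vec_lambda a \<bullet> y \<le> b}" for a b
  proof (intro set_eqI iffI)
    fix y :: "real ^ 'n" assume "y \<in> {y. vec_lambda a \<bullet> y \<le> b}"
    then have "vec_nth y \<in> {x \<in> euclid UNIV. (\<Sum>i\<in>UNIV. a i * x i) \<le> b}"
      by (simp add: inner_vec_def euclid_def)
    then show "y \<in> vec_lambda ` {x \<in> euclid UNIV. (\<Sum>i\<in>UNIV. a i * x i) \<le> b}"
      by (metis (no_types, lifting) image_eqI vec_nth_inverse)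
  qed (auto simp: inner_vec_def)
  have inj: "inj (vec_lambda :: ('n \<Rightarrow> real) \<Rightarrow> _)"
    by (metis injI vec_lambda_inverse UNIV_I)
  have surj: "vec_lambda ` (UNIV :: ('n \<Rightarrow> real) set) = UNIV"
    by (metis surjI vec_nth_inverse)
  have E: "euclid (UNIV :: 'n set) = UNIV"
    by (auto simp: euclid_def)
  show ?thesis
  proof
    assume "polyhedron_in UNIV S"
    then obtain H where H: "finite H" "\<forall>h\<in>H. halfspace_in UNIV h" "S = \<Inter>H"
      by (auto simp: polyhedron_in_def E)
    have "polyhedron (vec_lambda ` h)" if "h \<in> H" for h
      using H(2) that half by (auto simp: halfspace_in_def polyhedron_halfspace_le)
    moreover have "vec_lambda ` S = \<Inter>((`) vec_lambda ` H)"
    proof -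
      have "bij (vec_lambda :: ('n \<Rightarrow> real) \<Rightarrow> _)"
        using inj surj by (rule bijI)
      from bij_image_INT[OF this, of id H] show ?thesis
        unfolding H(3) by simp
    qed
    ultimately show "polyhedron (vec_lambda ` S)"
      using H(1) by auto
  next
    assume "polyhedron (vec_lambda ` S)"
    then obtain F where F: "finite F" "vec_lambda ` S = \<Inter>F"
      "\<forall>h\<in>F. \<exists>a b. a \<noteq> 0 \<and> h = {x. a \<bullet> x \<le> b}"
      unfolding polyhedron_def by blast
    have S: "S = \<Inter>((-`) vec_lambda ` F)"
    proof -
      have "S = vec_lambda -` \<Inter>F"
        using inj_vimage_image_eq[OF inj, of S] unfolding F(2) by (rule sym)
      then show ?thesis by blast
    qed
    have "halfspace_in UNIV (vec_lambda -` h)" if h: "h \<in> F" for h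
    proof -
      obtain a b where "h = {x. a \<bullet> x \<le> b}"
        using F(3) h by blast
      then have "vec_lambda -` h = {x \<in> UNIV. (\<Sum>i\<in>UNIV. a $ i * x i) \<le> b}"
        by (simp add: inner_vec_def vimage_def)
      then show ?thesis
        unfolding halfspace_in_def E by blast
    qed
    then have "\<forall>h\<in>(-`) vec_lambda ` F. halfspace_in UNIV h"
      by blast
    then show "polyhedron_in UNIV S"
      unfolding polyhedron_in_def E Int_UNIV_left using F(1) S by blast
  qed
qed

text \<open>
  \<open>S\<close> is the set of feasible pairs (functionality, resource); the condition says that it is an upper
  set of the product of the opposite of \<open>F\<close> with \<open>R\<close>.
\<close>

definition design_problem ::
    "('i \<Rightarrow> real) set \<Rightarrow> ('j \<Rightarrow> real) set \<Rightarrow> (('i \<Rightarrow> real) \<times> ('j \<Rightarrow> real)) set \<Rightarrow> bool" where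
  "design_problem F R S \<longleftrightarrow> S \<subseteq> F \<times> R \<and>
     (\<forall>f r f' r'. (f, r) \<in> S \<and> f' \<in> F \<and> r' \<in> R \<and> f' \<le> f \<and> r \<le> r' \<longrightarrow> (f', r') \<in> S)"

text \<open>A pair in \<open>\<real>\<^sup>I \<times> \<real>\<^sup>J\<close> is identified with a point of \<open>\<real>\<^sup>K\<close>, \<open>K = I <+> J\<close>.\<close>

definition polyhedron_pair_in ::
    "'i set \<Rightarrow> 'j set \<Rightarrow> (('i \<Rightarrow> real) \<times> ('j \<Rightarrow> real)) set \<Rightarrow> bool" where
  "polyhedron_pair_in I J S \<longleftrightarrow>
     S \<subseteq> euclid I \<times> euclid J \<and> polyhedron_in (I <+> J) ((\<lambda>(x, y). case_sum x y) ` S)"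

definition linear_design_problem ::
    "'i set \<Rightarrow> ('i \<Rightarrow> real) set \<Rightarrow> 'j set \<Rightarrow> ('j \<Rightarrow> real) set
     \<Rightarrow> (('i \<Rightarrow> real) \<times> ('j \<Rightarrow> real)) set \<Rightarrow> bool" where
  "linear_design_problem I F J R S \<longleftrightarrow>
     euclid_subposet I F \<and> euclid_subposet J R \<and> design_problem F R S \<and> polyhedron_pair_in I J S"

text \<open>
  The product over \<open>k \<in> K\<close> of posets \<open>P k\<close>, each in the space of dimension \<open>n k\<close>, is realised inside
  the Euclidean space whose coordinates are the pairs \<open>(k, j)\<close> with \<open>k \<in> K\<close> and \<open>j < n k\<close>;
  \<open>port_value n x k\<close> is the \<open>k\<close>-th component of the point \<open>x\<close>.
\<close>

definition prod_index :: "'k set \<Rightarrow> ('k \<Rightarrow> nat) \<Rightarrow> ('k \<times> nat) set" where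
  "prod_index K n = (SIGMA k:K. {..<n k})"

definition port_value :: "('k \<Rightarrow> nat) \<Rightarrow> ('k \<times> nat \<Rightarrow> real) \<Rightarrow> 'k \<Rightarrow> (nat \<Rightarrow> real)" where
  "port_value n x k = (\<lambda>j\<in>{..<n k}. x (k, j))"

definition prod_poset ::
    "'k set \<Rightarrow> ('k \<Rightarrow> nat) \<Rightarrow> ('k \<Rightarrow> (nat \<Rightarrow> real) set) \<Rightarrow> ('k \<times> nat \<Rightarrow> real) set" where
  "prod_poset K n P = {x \<in> euclid (prod_index K n). \<forall>k\<in>K. port_value n x k \<in> P k}"

text \<open>
  Node \<open>d\<close> has the functionality ports \<open>i < num_fun d\<close> and the resource ports \<open>j < num_res d\<close>.
  An edge \<open>((d1, i1), (d2, j2))\<close> goes from a resource port of \<open>d1\<close> to a functionality port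
  of \<open>d2\<close>. Parallel edges between two nodes are distinguished by their ports.
\<close>

record 'v codesign =
  nodes :: "'v set"
  num_fun :: "'v \<Rightarrow> nat"
  num_res :: "'v \<Rightarrow> nat"
  fun_dim :: "'v \<Rightarrow> nat \<Rightarrow> nat"
  res_dim :: "'v \<Rightarrow> nat \<Rightarrow> nat"
  fun_port :: "'v \<Rightarrow> nat \<Rightarrow> (nat \<Rightarrow> real) set"
  res_port :: "'v \<Rightarrow> nat \<Rightarrow> (nat \<Rightarrow> real) set"
  feasible :: "'v \<Rightarrow> ((nat \<times> nat \<Rightarrow> real) \<times> (nat \<times> nat \<Rightarrow> real)) set"
  edges :: "(('v \<times> nat) \<times> ('v \<times> nat)) set"

definition fun_index :: "'v codesign \<Rightarrow> 'v \<Rightarrow> (nat \<times> nat) set" where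
  "fun_index G d = prod_index {..<num_fun G d} (fun_dim G d)"

definition res_index :: "'v codesign \<Rightarrow> 'v \<Rightarrow> (nat \<times> nat) set" where
  "res_index G d = prod_index {..<num_res G d} (res_dim G d)"

definition fun_space :: "'v codesign \<Rightarrow> 'v \<Rightarrow> (nat \<times> nat \<Rightarrow> real) set" where
  "fun_space G d = prod_poset {..<num_fun G d} (fun_dim G d) (fun_port G d)"

definition res_space :: "'v codesign \<Rightarrow> 'v \<Rightarrow> (nat \<times> nat \<Rightarrow> real) set" where
  "res_space G d = prod_poset {..<num_res G d} (res_dim G d) (res_port G d)"

definition lcdp :: "'v codesign \<Rightarrow> bool" where
  "lcdp G \<longleftrightarrow>
     finite (nodes G) \<and> finite (edges G) \<and>
     (\<forall>d\<in>nodes G.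
        (\<forall>i<num_fun G d. euclid_subposet {..<fun_dim G d i} (fun_port G d i)) \<and>
        (\<forall>i<num_res G d. euclid_subposet {..<res_dim G d i} (res_port G d i)) \<and>
        linear_design_problem (fun_index G d) (fun_space G d) (res_index G d) (res_space G d)
          (feasible G d)) \<and>
     (\<forall>((d1, i1), (d2, j2))\<in>edges G.
        d1 \<in> nodes G \<and> i1 < num_res G d1 \<and> d2 \<in> nodes G \<and> j2 < num_fun G d2 \<and>
        res_dim G d1 i1 = fun_dim G d2 j2 \<and> res_port G d1 i1 = fun_port G d2 j2)"

definition free_fun_ports :: "'v codesign \<Rightarrow> ('v \<times> nat) set" where
  "free_fun_ports G = (SIGMA d:nodes G. {..<num_fun G d}) - snd ` edges G"

definition free_res_ports :: "'v codesign \<Rightarrow> ('v \<times> nat) set" where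
  "free_res_ports G = (SIGMA d:nodes G. {..<num_res G d}) - fst ` edges G"

definition system_fun_index :: "'v codesign \<Rightarrow> (('v \<times> nat) \<times> nat) set" where
  "system_fun_index G = prod_index (free_fun_ports G) (case_prod (fun_dim G))"

definition system_res_index :: "'v codesign \<Rightarrow> (('v \<times> nat) \<times> nat) set" where
  "system_res_index G = prod_index (free_res_ports G) (case_prod (res_dim G))"

definition system_fun_space :: "'v codesign \<Rightarrow> (('v \<times> nat) \<times> nat \<Rightarrow> real) set" where
  "system_fun_space G =
     prod_poset (free_fun_ports G) (case_prod (fun_dim G)) (case_prod (fun_port G))"

definition system_res_space :: "'v codesign \<Rightarrow> (('v \<times> nat) \<times> nat \<Rightarrow> real) set" where
  "system_res_space G =
     prod_poset (free_res_ports G) (case_prod (res_dim G)) (case_prod (res_port G))"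

text \<open>The values of all ports of node \<open>d\<close> are collected in \<open>u d\<close> (functionalities) and \<open>v d\<close> (resources).\<close>

definition ldp_tot ::
    "'v codesign \<Rightarrow> ((('v \<times> nat) \<times> nat \<Rightarrow> real) \<times> (('v \<times> nat) \<times> nat \<Rightarrow> real)) set" where
  "ldp_tot G = {(x, y). x \<in> system_fun_space G \<and> y \<in> system_res_space G \<and>
     (\<exists>u v.
        (\<forall>(d, i)\<in>free_fun_ports G.
           port_value (fun_dim G d) (u d) i = port_value (case_prod (fun_dim G)) x (d, i)) \<and>
        (\<forall>(d, j)\<in>free_res_ports G.
           port_value (res_dim G d) (v d) j = port_value (case_prod (res_dim G)) y (d, j)) \<and>
        (\<forall>d\<in>nodes G. (u d, v d) \<in> feasible G d) \<and>
        (\<forall>((d1, i1), (d2, j2))\<in>edges G.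
           port_value (res_dim G d1) (v d1) i1 \<le> port_value (fun_dim G d2) (u d2) j2))}"

end

theory Submission imports Defs begin

text \<open>
  Give every port of every node its own coordinates. The assignments of values to all ports
  that are feasible at each node and satisfy the edge inequalities form a set
  \<open>joint_feasible G\<close> in this large space. It is a polyhedron
  (\<open>polyhedron_pair_in_joint_feasible\<close>): feasibility at a node is the preimage of a polyhedron under
  the map that selects the coordinates of that node, and an edge is a finite system of inequalities
  between pairs of coordinates.

  The composite keeps only the unconnected ports, so its feasible set is the projection of
  \<open>joint_feasible G\<close> to their coordinates (\<open>ldp_tot_eq_restrict_joint_feasible\<close>). Membership in
  the port posets is automatic there, because each node relation lies in the product of its port
  posets. A projection of a polyhedron is a polyhedron by Fourier-Motzkin elimination, one
  coordinate at a time (\<open>polyhedron_in_projection\<close>).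

  Monotonicity of the composite (\<open>design_problem_ldp_tot\<close>) comes from changing a feasible assignment
  at the unconnected ports only. No edge sees the change, and each node tolerates it
  because its own relation is an upper set.
\<close>

section \<open>Polyhedra given by finite index sets\<close>

text \<open>
  Halfspaces as sets do not determine their normal vectors. Elimination and substitution compute
  with coefficients, so they need one system of inequalities chosen once and for all.
\<close>

lemma polyhedron_in_iff_finite_system:
  "polyhedron_in I S \<longleftrightarrow>
     (\<exists>C. finite C \<and> S = {x \<in> euclid I. \<forall>(a, b)\<in>C. (\<Sum>i\<in>I. a i * x i) \<le> b})"
proof
  assume "polyhedron_in I S"
  then obtain H where H: "finite H" "\<forall>h\<in>H. halfspace_in I h" "S = euclid I \<inter> \<Inter>H"
    by (auto simp: polyhedron_in_def)
  from H(2) obtain a b where ab: "\<And>h. h \<in> H \<Longrightarrow> h = {x \<in> euclid I. (\<Sum>i\<in>I. a h i * x i) \<le> b h}"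
    unfolding halfspace_in_def by metis
  have "S = {x \<in> euclid I. \<forall>(a, b)\<in>(\<lambda>h. (a h, b h)) ` H. (\<Sum>i\<in>I. a i * x i) \<le> b}"
    unfolding H(3) using ab by blast
  then show "\<exists>C. finite C \<and> S = {x \<in> euclid I. \<forall>(a, b)\<in>C. (\<Sum>i\<in>I. a i * x i) \<le> b}"
    using H(1) by blast
next
  assume "\<exists>C. finite C \<and> S = {x \<in> euclid I. \<forall>(a, b)\<in>C. (\<Sum>i\<in>I. a i * x i) \<le> b}"
  then obtain C where C: "finite C" "S = {x \<in> euclid I. \<forall>(a, b)\<in>C. (\<Sum>i\<in>I. a i * x i) \<le> b}"
    by blast
  let ?h = "\<lambda>(a, b). {x \<in> euclid I. (\<Sum>i\<in>I. a i * x i) \<le> b}"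
  have "S = euclid I \<inter> \<Inter>(?h ` C)"
    unfolding C(2) by auto
  moreover have "\<forall>h\<in>?h ` C. halfspace_in I h"
    by (auto simp: halfspace_in_def)
  ultimately show "polyhedron_in I S"
    unfolding polyhedron_in_def using C(1) by blast
qed

lemma polyhedron_in_subset: "polyhedron_in I S \<Longrightarrow> S \<subseteq> euclid I"
  by (auto simp: polyhedron_in_def)

lemma polyhedron_in_Int:
  assumes "polyhedron_in I S" "polyhedron_in I T"
  shows "polyhedron_in I (S \<inter> T)"
proof -
  obtain H H' where "finite H" "\<forall>h\<in>H. halfspace_in I h" "S = euclid I \<inter> \<Inter>H"
    "finite H'" "\<forall>h\<in>H'. halfspace_in I h" "T = euclid I \<inter> \<Inter>H'"
    using assms by (auto simp: polyhedron_in_def)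
  then have "finite (H \<union> H')" "\<forall>h\<in>H \<union> H'. halfspace_in I h" "S \<inter> T = euclid I \<inter> \<Inter>(H \<union> H')"
    by auto
  then show ?thesis
    unfolding polyhedron_in_def by (intro exI[of _ "H \<union> H'"] conjI)
qed

lemma polyhedron_in_euclid: "polyhedron_in I (euclid I)"
  unfolding polyhedron_in_def by (rule exI[of _ "{}"]) simp

lemma polyhedron_in_Ball:
  assumes "finite A" "\<And>a. a \<in> A \<Longrightarrow> polyhedron_in I {x \<in> euclid I. P a x}"
  shows "polyhedron_in I {x \<in> euclid I. \<forall>a\<in>A. P a x}"
  using assms
proof (induction A rule: finite_induct)
  case empty
  then show ?case by (simp add: polyhedron_in_euclid)
next
  case (insert a A)
  have "{x \<in> euclid I. \<forall>a\<in>insert a A. P a x}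
      = {x \<in> euclid I. P a x} \<inter> {x \<in> euclid I. \<forall>a\<in>A. P a x}"
    by auto
  then show ?case
    using insert by (auto intro: polyhedron_in_Int)
qed

lemma polyhedron_in_coordinate_le:
  assumes "finite I" "p \<in> I" "q \<in> I"
  shows "polyhedron_in I {x \<in> euclid I. x p \<le> x q}"
proof -
  let ?a = "\<lambda>i. (if i = p then 1 else 0) - (if i = q then 1 else (0::real))"
  have "(\<Sum>i\<in>I. ?a i * x i) = x p - x q" for x
  proof -
    have "(\<Sum>i\<in>I. ?a i * x i) = (\<Sum>i\<in>I. (if i = p then x i else 0) - (if i = q then x i else 0))"
      by (rule sum.cong) auto
    then show ?thesis
      using assms by (simp add: sum_subtractf)
  qed
  then have "{x \<in> euclid I. x p \<le> x q}
      = {x \<in> euclid I. \<forall>(a, b)\<in>{(?a, 0)}. (\<Sum>i\<in>I. a i * x i) \<le> b}"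
    by simp
  then show ?thesis
    unfolding polyhedron_in_iff_finite_system by blast
qed

text \<open>
  Substituting \<open>x i = w (g i)\<close> in a linear inequality gives a linear inequality in \<open>w\<close>, in which the
  coefficient of \<open>w k\<close> collects the coefficients of all \<open>i\<close> with \<open>g i = k\<close>.
\<close>

lemma polyhedron_in_coordinate_preimage:
  assumes "finite I" "finite K" "g ` I \<subseteq> K" "polyhedron_in I S"
  shows "polyhedron_in K {w \<in> euclid K. (\<lambda>i\<in>I. w (g i)) \<in> S}"
proof -
  obtain C where C: "finite C" "S = {x \<in> euclid I. \<forall>(a, b)\<in>C. (\<Sum>i\<in>I. a i * x i) \<le> b}"
    using assms(4) unfolding polyhedron_in_iff_finite_system by blast
  have sum: "(\<Sum>k\<in>K. (\<Sum>i\<in>{i \<in> I. g i = k}. a i) * w k) = (\<Sum>i\<in>I. a i * (\<lambda>i\<in>I. w (g i)) i)"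
    for a w :: "_ \<Rightarrow> real"
  proof -
    have "(\<Sum>k\<in>K. (\<Sum>i\<in>{i \<in> I. g i = k}. a i) * w k)
        = (\<Sum>k\<in>K. \<Sum>i\<in>{i \<in> I. g i = k}. a i * w (g i))"
      by (simp add: sum_distrib_right)
    also have "\<dots> = (\<Sum>i\<in>I. a i * w (g i))"
      using assms(1-3) by (rule sum.group)
    finally show ?thesis by simp
  qed
  let ?C = "(\<lambda>(a, b). (\<lambda>k. \<Sum>i\<in>{i \<in> I. g i = k}. a i, b)) ` C"
  have "{w \<in> euclid K. (\<lambda>i\<in>I. w (g i)) \<in> S}
      = {w \<in> euclid K. \<forall>(a, b)\<in>?C. (\<Sum>k\<in>K. a k * w k) \<le> b}"
    unfolding C(2) by (auto simp: sum euclid_def)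
  then show ?thesis
    unfolding polyhedron_in_iff_finite_system using C(1) by blast
qed

section \<open>Fourier-Motzkin elimination\<close>

lemma finite_sets_separated_by_point:
  fixes L U :: "real set"
  assumes "finite L" "finite U" "\<And>l u. l \<in> L \<Longrightarrow> u \<in> U \<Longrightarrow> l \<le> u"
  shows "\<exists>t. (\<forall>l\<in>L. l \<le> t) \<and> (\<forall>u\<in>U. t \<le> u)"
proof (cases "L = {}")
  case True
  show ?thesis
  proof (cases "U = {}")
    case False
    then show ?thesis
      using True assms(2) by (intro exI[of _ "Min U"]) simp
  qed (use True in simp)
next
  case False
  then show ?thesis
    using assms by (intro exI[of _ "Max L"]) simp
qed

text \<open>
  Each inequality with \<open>c < 0\<close> bounds \<open>t\<close> from below by \<open>r / c\<close>, each one with \<open>c > 0\<close> bounds it from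
  above, and a solution exists as soon as every lower bound is at most every upper bound. The last
  condition is this comparison with the denominators cleared, which keeps it linear
  in the right-hand sides: these will be linear forms in the remaining coordinates.
\<close>

lemma univariate_system_solvable_iff:
  fixes C :: "(real \<times> real) set"
  assumes "finite C"
  shows "(\<exists>t. \<forall>(c, r)\<in>C. c * t \<le> r) \<longleftrightarrow>
    (\<forall>(c, r)\<in>C. c = 0 \<longrightarrow> 0 \<le> r) \<and>
    (\<forall>(c, r)\<in>C. \<forall>(c', r')\<in>C. c < 0 \<and> 0 < c' \<longrightarrow> 0 \<le> c' * r - c * r')" (is "?L \<longleftrightarrow> ?R")
proof
  assume ?L
  then obtain t where t: "\<And>c r. (c, r) \<in> C \<Longrightarrow> c * t \<le> r"
    by blast
  have "0 \<le> r" if "(0, r) \<in> C" for r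
    using t[OF that] by simp
  moreover have "0 \<le> c' * r - c * r'" if "(c, r) \<in> C" "(c', r') \<in> C" "c < 0" "0 < c'" for c r c' r'
  proof -
    have "c' * (c * t) \<le> c' * r" "- c * (c' * t) \<le> - c * r'"
      using t[OF that(1)] t[OF that(2)] that(3,4) by (auto intro!: mult_left_mono simp del: mult_minus_left)
    then show ?thesis
      by (simp add: algebra_simps)
  qed
  ultimately show ?R
    by fastforce
next
  assume R: ?R
  let ?q = "\<lambda>(c, r). r / c :: real"
  let ?N = "{p \<in> C. fst p < 0}" and ?P = "{p \<in> C. 0 < fst p}"
  have "l \<le> u" if lu: "l \<in> ?q ` ?N" "u \<in> ?q ` ?P" for l u
  proof -
    obtain c r c' r' where *: "(c, r) \<in> C" "c < 0" "l = r / c" "(c', r') \<in> C" "0 < c'" "u = r' / c'"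
      using lu by auto
    then have "0 \<le> c' * r - c * r'"
      using R by blast
    then show ?thesis
      unfolding *(3,6) using *(2,5)
      by (simp add: neg_divide_le_eq pos_divide_le_eq mult.commute)
  qed
  then obtain t where t: "\<forall>l\<in>?q ` ?N. l \<le> t" "\<forall>u\<in>?q ` ?P. t \<le> u"
    using finite_sets_separated_by_point[of "?q ` ?N" "?q ` ?P"] assms by auto
  have "c * t \<le> r" if cr: "(c, r) \<in> C" for c r
  proof -
    consider "c = 0" | "c < 0" | "0 < c" by linarith
    then show ?thesis
    proof cases
      case 1
      then show ?thesis using R cr by auto
    next
      case 2
      then have "r / c \<le> t" using t(1) cr by force
      then show ?thesis using 2 by (simp add: field_simps)
    next
      case 3
      then have "t \<le> r / c" using t(2) cr by force
      then show ?thesis using 3 by (simp add: field_simps)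
    qed
  qed
  then show ?L by blast
qed

text \<open>
  A Fourier-Motzkin step. A point \<open>z\<close> of \<open>\<real>\<^sup>I\<close> lifts to \<open>S\<close> exactly if a system in the single
  unknown \<open>t\<close>, the value of coordinate \<open>k\<close>, is solvable; the criterion for
  this is a finite system of linear inequalities in \<open>z\<close>.
\<close>

lemma polyhedron_in_eliminate_coordinate:
  assumes "finite I" "k \<notin> I" "polyhedron_in (insert k I) S"
  shows "polyhedron_in I ((\<lambda>w. restrict w I) ` S)"
proof -
  obtain C where C: "finite C"
    "S = {x \<in> euclid (insert k I). \<forall>(a, b)\<in>C. (\<Sum>i\<in>insert k I. a i * x i) \<le> b}"
    using assms(3) unfolding polyhedron_in_iff_finite_system by blast
  define s where "s a z = (\<Sum>i\<in>I. a i * z i)" for a z :: "_ \<Rightarrow> real"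
  have sum_upd: "(\<Sum>i\<in>insert k I. a i * (z(k := t)) i) = s a z + a k * t" for a z t
  proof -
    have "(\<Sum>i\<in>I. a i * (z(k := t)) i) = s a z"
      unfolding s_def using assms(2) by (intro sum.cong) auto
    then show ?thesis using assms(1,2) by simp
  qed
  have image: "(\<lambda>w. restrict w I) ` S =
      {z \<in> euclid I. \<exists>t. \<forall>(c, r)\<in>(\<lambda>(a, b). (a k, b - s a z)) ` C. c * t \<le> r}"
  proof (intro set_eqI iffI)
    fix z assume "z \<in> (\<lambda>w. restrict w I) ` S"
    then obtain w where w: "w \<in> S" "z = restrict w I" by blast
    have "(\<Sum>i\<in>insert k I. a i * w i) = s a z + a k * w k" for a
      using assms(1,2) by (simp add: s_def w(2))
    then have "a k * w k \<le> b - s a z" if "(a, b) \<in> C" for a b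
      using w(1) that unfolding C(2) by force
    then show "z \<in> {z \<in> euclid I. \<exists>t. \<forall>(c, r)\<in>(\<lambda>(a, b). (a k, b - s a z)) ` C. c * t \<le> r}"
      unfolding w(2) by (auto simp: euclid_def intro!: exI[of _ "w k"])
  next
    fix z assume "z \<in> {z \<in> euclid I. \<exists>t. \<forall>(c, r)\<in>(\<lambda>(a, b). (a k, b - s a z)) ` C. c * t \<le> r}"
    then obtain t where z: "z \<in> euclid I"
      and t: "\<forall>(a, b)\<in>C. a k * t \<le> b - s a z"
      by (auto simp: case_prod_beta)
    have "z(k := t) \<in> euclid (insert k I)"
      using z by (auto simp: euclid_def PiE_def extensional_def)
    moreover have "\<forall>(a, b)\<in>C. (\<Sum>i\<in>insert k I. a i * (z(k := t)) i) \<le> b"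
      unfolding sum_upd using t by force
    ultimately have "z(k := t) \<in> S"
      unfolding C(2) by blast
    moreover have "restrict (z(k := t)) I = z"
      using z assms(2) by (auto simp: euclid_def PiE_def extensional_def restrict_def)
    ultimately show "z \<in> (\<lambda>w. restrict w I) ` S"
      by (metis (no_types, lifting) image_eqI)
  qed
  \<comment> \<open>The new system keeps the inequalities without \<open>k\<close> and combines each pair with opposite signs
    at \<open>k\<close>, with positive weights \<open>a' k\<close> and \<open>- a k\<close> chosen so that the coefficient of \<open>k\<close> cancels.\<close>
  let ?Z = "{p \<in> C. fst p k = 0}" and ?N = "{p \<in> C. fst p k < 0}" and ?P = "{p \<in> C. 0 < fst p k}"
  let ?comb = "\<lambda>((a, b), (a', b')). (\<lambda>i. a' k * a i - a k * a' i, a' k * b - a k * b')"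
  have s_comb: "s (\<lambda>i. x * a i - y * a' i) z = x * s a z - y * s a' z" for x y a a' z
    by (simp add: s_def sum_subtractf sum_distrib_left algebra_simps)
  have "(\<lambda>w. restrict w I) ` S = {z \<in> euclid I. \<forall>(a, b)\<in>?Z \<union> ?comb ` (?N \<times> ?P). s a z \<le> b}"
  proof -
    have "(\<exists>t. \<forall>(c, r)\<in>(\<lambda>(a, b). (a k, b - s a z)) ` C. c * t \<le> r) \<longleftrightarrow>
        (\<forall>(a, b)\<in>C. a k = 0 \<longrightarrow> 0 \<le> b - s a z) \<and>
        (\<forall>(a, b)\<in>C. \<forall>(a', b')\<in>C. a k < 0 \<and> 0 < a' k \<longrightarrow>
           0 \<le> a' k * (b - s a z) - a k * (b' - s a' z))" for z
      using C(1) by (subst univariate_system_solvable_iff) (simp_all add: case_prod_beta)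
    also have "\<dots> z \<longleftrightarrow> (\<forall>(a, b)\<in>?Z. s a z \<le> b) \<and> (\<forall>(a, b)\<in>?comb ` (?N \<times> ?P). s a z \<le> b)"
      for z
    proof -
      have "0 \<le> a' k * (b - s a z) - a k * (b' - s a' z) \<longleftrightarrow>
          s (\<lambda>i. a' k * a i - a k * a' i) z \<le> a' k * b - a k * b'" for a b a' b'
        unfolding s_comb by (auto simp: algebra_simps)
      then show ?thesis
        by (simp add: case_prod_beta, simp add: Ball_def split_paired_All) blast
    qed
    also have "\<dots> z \<longleftrightarrow> (\<forall>(a, b)\<in>?Z \<union> ?comb ` (?N \<times> ?P). s a z \<le> b)" for z
      by (simp only: ball_Un)
    finally show ?thesis
      unfolding image by blast
  qed
  moreover have "finite (?Z \<union> ?comb ` (?N \<times> ?P))"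
    using C(1) by simp
  ultimately show ?thesis
    unfolding polyhedron_in_iff_finite_system s_def by blast
qed

theorem polyhedron_in_projection:
  assumes "finite K" "J \<subseteq> K" "polyhedron_in K S"
  shows "polyhedron_in J ((\<lambda>w. restrict w J) ` S)"
proof -
  have "polyhedron_in J ((\<lambda>w. restrict w J) ` S)"
    if "finite E" "finite J" "E \<inter> J = {}" "polyhedron_in (E \<union> J) S" for E
    using that
  proof (induction E arbitrary: S rule: finite_induct)
    case empty
    have "restrict w J = w" if "w \<in> S" for w
      using polyhedron_in_subset[OF empty(3)] that by (auto simp: euclid_def PiE_restrict)
    then have "(\<lambda>w. restrict w J) ` S = S" by auto
    then show ?case using empty by (simp only: Un_empty_left)
  next
    case (insert k E)
    have "polyhedron_in (E \<union> J) ((\<lambda>w. restrict w (E \<union> J)) ` S)"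
      using insert by (intro polyhedron_in_eliminate_coordinate) auto
    then have "polyhedron_in J ((\<lambda>w. restrict w J) ` (\<lambda>w. restrict w (E \<union> J)) ` S)"
      using insert by (intro insert.IH) auto
    moreover have "(\<lambda>w. restrict w J) ` (\<lambda>w. restrict w (E \<union> J)) ` S = (\<lambda>w. restrict w J) ` S"
      by (simp add: image_image Int_absorb1)
    ultimately show ?case by (simp only:)
  qed
  from this[of "K - J"] show ?thesis
    using assms by (simp add: finite_subset Un_absorb2 Int_commute[of _ J])
qed


section \<open>Port values of single nodes and of the whole network\<close>

lemma euclid_subposet_prod_poset:
  assumes "finite K" "\<And>k. k \<in> K \<Longrightarrow> euclid_subposet {..<n k} (P k)"
  shows "euclid_subposet (prod_index K n) (prod_poset K n P)"
proof -
  have "0 \<le> x (k, j)" if "x \<in> prod_poset K n P" "k \<in> K" "j < n k" for x k j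
  proof -
    have "port_value n x k \<in> P k"
      using that by (simp add: prod_poset_def)
    then have "0 \<le> port_value n x k j"
      using assms(2)[OF that(2)] that(3) by (auto simp: euclid_subposet_def)
    then show ?thesis
      using that(3) by (simp add: port_value_def)
  qed
  then show ?thesis
    using assms(1) by (auto simp: euclid_subposet_def prod_index_def prod_poset_def)
qed

text \<open>
  Coordinates of the whole network are indexed by \<open>((d, i), j)\<close>: node, port, position within the
  port. Fixing \<open>d\<close> gives back the index set of the node \<open>d\<close>, which consists of pairs \<open>(i, j)\<close>.
\<close>

definition node_slice ::
    "(nat \<times> nat) set \<Rightarrow> 'v \<Rightarrow> (('v \<times> nat) \<times> nat \<Rightarrow> real) \<Rightarrow> nat \<times> nat \<Rightarrow> real" where
  "node_slice I d f = (\<lambda>c\<in>I. f ((d, fst c), snd c))"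

lemma port_value_node_slice:
  assumes "i < m d"
  shows "port_value (n d) (node_slice (prod_index {..<m d} (n d)) d f) i
    = port_value (case_prod n) f (d, i)"
  using assms by (auto simp: port_value_def node_slice_def prod_index_def)

lemma node_slice_in_prod_poset_iff:
  "node_slice (prod_index {..<m d} (n d)) d f \<in> prod_poset {..<m d} (n d) P \<longleftrightarrow>
     (\<forall>i<m d. port_value (case_prod n) f (d, i) \<in> P i)"
  by (auto simp: prod_poset_def port_value_node_slice) (simp add: node_slice_def euclid_def)

definition all_fun_ports :: "'v codesign \<Rightarrow> ('v \<times> nat) set" where
  "all_fun_ports G = (SIGMA d:nodes G. {..<num_fun G d})"

definition all_res_ports :: "'v codesign \<Rightarrow> ('v \<times> nat) set" where
  "all_res_ports G = (SIGMA d:nodes G. {..<num_res G d})"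

definition all_fun_index :: "'v codesign \<Rightarrow> (('v \<times> nat) \<times> nat) set" where
  "all_fun_index G = prod_index (all_fun_ports G) (case_prod (fun_dim G))"

definition all_res_index :: "'v codesign \<Rightarrow> (('v \<times> nat) \<times> nat) set" where
  "all_res_index G = prod_index (all_res_ports G) (case_prod (res_dim G))"

text \<open>
  An assignment \<open>u\<close>, \<open>v\<close> of node-wise values, as in \<open>ldp_tot\<close>, is stored in one point \<open>(f, r)\<close> of a
  Euclidean space that contains the system-level space as a coordinate subspace. The projection
  to the unconnected ports is then a restriction of functions.
\<close>

definition joint_feasible ::
    "'v codesign \<Rightarrow> ((('v \<times> nat) \<times> nat \<Rightarrow> real) \<times> (('v \<times> nat) \<times> nat \<Rightarrow> real)) set" where
  "joint_feasible G = {(f, r). f \<in> euclid (all_fun_index G) \<and> r \<in> euclid (all_res_index G) \<and>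
     (\<forall>d\<in>nodes G. (node_slice (fun_index G d) d f, node_slice (res_index G d) d r) \<in> feasible G d) \<and>
     (\<forall>(p, q)\<in>edges G. \<forall>j<case_prod (fun_dim G) q. r (p, j) \<le> f (q, j))}"

lemma lcdp_node:
  assumes "lcdp G" "d \<in> nodes G"
  shows "linear_design_problem (fun_index G d) (fun_space G d) (res_index G d) (res_space G d)
           (feasible G d)"
    and "i < num_fun G d \<Longrightarrow> euclid_subposet {..<fun_dim G d i} (fun_port G d i)"
    and "i < num_res G d \<Longrightarrow> euclid_subposet {..<res_dim G d i} (res_port G d i)"
  using assms by (auto simp: lcdp_def)

lemma lcdp_edge:
  assumes "lcdp G" "((d1, i1), (d2, j2)) \<in> edges G"
  shows "d1 \<in> nodes G" "i1 < num_res G d1" "d2 \<in> nodes G" "j2 < num_fun G d2"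
    and "res_dim G d1 i1 = fun_dim G d2 j2"
  using assms by (auto simp: lcdp_def)

lemma free_ports_subset:
  "free_fun_ports G \<subseteq> all_fun_ports G" "free_res_ports G \<subseteq> all_res_ports G"
  by (auto simp: free_fun_ports_def all_fun_ports_def free_res_ports_def all_res_ports_def)

lemma system_index_subset:
  "system_fun_index G \<subseteq> all_fun_index G" "system_res_index G \<subseteq> all_res_index G"
  using free_ports_subset[of G]
  by (auto simp: system_fun_index_def all_fun_index_def system_res_index_def all_res_index_def
      prod_index_def)

lemma finite_all_index:
  assumes "lcdp G"
  shows "finite (all_fun_index G)" "finite (all_res_index G)"
  using assms
  by (auto simp: lcdp_def all_fun_index_def all_res_index_def all_fun_ports_def all_res_ports_def
      prod_index_def)

lemma port_value_edge_le_iff: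
  assumes "n p = n' q"
  shows "port_value n r p \<le> port_value n' f q \<longleftrightarrow> (\<forall>j<n' q. r (p, j) \<le> f (q, j))"
  using assms by (auto simp: port_value_def le_fun_def)

text \<open>
  The relation of each node is contained in the product of its port posets, so membership in the
  posets is implied by feasibility.
\<close>

lemma joint_feasible_ports:
  assumes "lcdp G" "(f, r) \<in> joint_feasible G"
  shows "(d, i) \<in> all_fun_ports G \<Longrightarrow> port_value (case_prod (fun_dim G)) f (d, i) \<in> fun_port G d i"
    and "(d, i) \<in> all_res_ports G \<Longrightarrow> port_value (case_prod (res_dim G)) r (d, i) \<in> res_port G d i"
proof -
  have "node_slice (fun_index G d) d f \<in> fun_space G d"
    "node_slice (res_index G d) d r \<in> res_space G d" if "d \<in> nodes G" for d
    using assms(2) that lcdp_node(1)[OF assms(1) that]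
    by (auto simp: joint_feasible_def linear_design_problem_def design_problem_def)
  then show "(d, i) \<in> all_fun_ports G \<Longrightarrow> port_value (case_prod (fun_dim G)) f (d, i) \<in> fun_port G d i"
    and "(d, i) \<in> all_res_ports G \<Longrightarrow> port_value (case_prod (res_dim G)) r (d, i) \<in> res_port G d i"
    by (auto simp: all_fun_ports_def all_res_ports_def fun_index_def fun_space_def res_index_def
        res_space_def node_slice_in_prod_poset_iff)
qed

lemma port_value_restrict:
  "k \<in> K \<Longrightarrow> port_value n (restrict f (prod_index K n)) k = port_value n f k"
  by (auto simp: port_value_def prod_index_def)

lemma eq_restrict_iff_port_values:
  assumes "x \<in> euclid (prod_index K n)"
  shows "x = restrict f (prod_index K n) \<longleftrightarrow> (\<forall>k\<in>K. port_value n x k = port_value n f k)"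
proof
  assume *: "\<forall>k\<in>K. port_value n x k = port_value n f k"
  have "x (k, j) = f (k, j)" if "k \<in> K" "j < n k" for k j
    using *[rule_format, OF that(1), THEN fun_cong, of j] that by (simp add: port_value_def)
  then show "x = restrict f (prod_index K n)"
    using assms by (intro extensionalityI[of _ "prod_index K n"])
      (auto simp: euclid_def PiE_def prod_index_def)
qed (metis port_value_restrict)

text \<open>
  The two sides differ in how port values are stored. From left to right, the node-wise values are
  glued to one global assignment; slicing it returns them unchanged, since points of the node
  spaces are extensional. From right to left, the slices are the required witnesses.
\<close>

lemma ldp_tot_eq_restrict_joint_feasible:
  assumes G: "lcdp G"
  shows "ldp_tot G = (\<lambda>(f, r). (restrict f (system_fun_index G), restrict r (system_res_index G)))
    ` joint_feasible G"
proof (intro set_eqI iffI)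
  fix p assume "p \<in> ldp_tot G"
  then obtain x y u v where p: "p = (x, y)"
    and x: "x \<in> system_fun_space G" and y: "y \<in> system_res_space G"
    and u: "\<forall>(d, i)\<in>free_fun_ports G.
           port_value (fun_dim G d) (u d) i = port_value (case_prod (fun_dim G)) x (d, i)"
    and v: "\<forall>(d, j)\<in>free_res_ports G.
           port_value (res_dim G d) (v d) j = port_value (case_prod (res_dim G)) y (d, j)"
    and uv: "\<forall>d\<in>nodes G. (u d, v d) \<in> feasible G d"
    and e: "\<forall>((d1, i1), (d2, j2))\<in>edges G.
           port_value (res_dim G d1) (v d1) i1 \<le> port_value (fun_dim G d2) (u d2) j2"
    unfolding ldp_tot_def by blast
  define f where "f = (\<lambda>((d, i), j)\<in>all_fun_index G. u d (i, j))"
  define r where "r = (\<lambda>((d, i), j)\<in>all_res_index G. v d (i, j))"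
  have uv_spaces: "u d \<in> fun_space G d" "v d \<in> res_space G d" if "d \<in> nodes G" for d
    using uv that lcdp_node(1)[OF G that]
    by (auto simp: linear_design_problem_def design_problem_def)
  have f_slice: "node_slice (fun_index G d) d f = u d" if "d \<in> nodes G" for d
  proof (rule extensionalityI[of _ "fun_index G d"])
    show "u d \<in> extensional (fun_index G d)"
      using uv_spaces(1)[OF that]
      by (simp add: fun_space_def prod_poset_def euclid_def PiE_def fun_index_def)
  qed (use that in \<open>auto simp: node_slice_def f_def fun_index_def all_fun_index_def all_fun_ports_def
        prod_index_def\<close>)
  have r_slice: "node_slice (res_index G d) d r = v d" if "d \<in> nodes G" for d
  proof (rule extensionalityI[of _ "res_index G d"])
    show "v d \<in> extensional (res_index G d)"
      using uv_spaces(2)[OF that]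
      by (simp add: res_space_def prod_poset_def euclid_def PiE_def res_index_def)
  qed (use that in \<open>auto simp: node_slice_def r_def res_index_def all_res_index_def all_res_ports_def
        prod_index_def\<close>)
  have f_port: "port_value (fun_dim G d) (u d) i = port_value (case_prod (fun_dim G)) f (d, i)"
    if "(d, i) \<in> all_fun_ports G" for d i
    using that port_value_node_slice[of i "num_fun G" d "fun_dim G" f] f_slice[of d]
    by (auto simp: fun_index_def all_fun_ports_def)
  have r_port: "port_value (res_dim G d) (v d) i = port_value (case_prod (res_dim G)) r (d, i)"
    if "(d, i) \<in> all_res_ports G" for d i
    using that port_value_node_slice[of i "num_res G" d "res_dim G" r] r_slice[of d]
    by (auto simp: res_index_def all_res_ports_def)
  have "x = restrict f (system_fun_index G)"
    using x u f_port free_ports_subset(1)[of G] unfolding system_fun_index_def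
    by (subst eq_restrict_iff_port_values) (fastforce simp: system_fun_space_def prod_poset_def)+
  moreover have "y = restrict r (system_res_index G)"
    using y v r_port free_ports_subset(2)[of G] unfolding system_res_index_def
    by (subst eq_restrict_iff_port_values) (fastforce simp: system_res_space_def prod_poset_def)+
  moreover have "(f, r) \<in> joint_feasible G"
  proof -
    have "r ((d1, i1), j) \<le> f ((d2, j2), j)"
      if E: "((d1, i1), (d2, j2)) \<in> edges G" and j: "j < fun_dim G d2 j2" for d1 i1 d2 j2 j
    proof -
      have "port_value (case_prod (res_dim G)) r (d1, i1) \<le> port_value (case_prod (fun_dim G)) f (d2, j2)"
        using e E lcdp_edge[OF G E] f_port[of d2 j2] r_port[of d1 i1]
        by (auto simp: all_fun_ports_def all_res_ports_def)
      then show ?thesis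
        using j lcdp_edge(5)[OF G E] by (simp add: port_value_edge_le_iff)
    qed
    moreover have "f \<in> euclid (all_fun_index G)" "r \<in> euclid (all_res_index G)"
      by (simp_all add: f_def r_def euclid_def)
    ultimately show ?thesis
      using uv f_slice r_slice by (auto simp: joint_feasible_def)
  qed
  ultimately show "p \<in> (\<lambda>(f, r). (restrict f (system_fun_index G), restrict r (system_res_index G)))
      ` joint_feasible G"
    using p by force
next
  fix p assume "p \<in> (\<lambda>(f, r). (restrict f (system_fun_index G), restrict r (system_res_index G)))
      ` joint_feasible G"
  then obtain f r where p: "p = (restrict f (system_fun_index G), restrict r (system_res_index G))"
    and fr: "(f, r) \<in> joint_feasible G"
    by auto
  let ?u = "\<lambda>d. node_slice (fun_index G d) d f" and ?v = "\<lambda>d. node_slice (res_index G d) d r"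
  have f_port: "port_value (fun_dim G d) (?u d) i = port_value (case_prod (fun_dim G)) f (d, i)"
    if "(d, i) \<in> all_fun_ports G" for d i
    using that by (simp add: fun_index_def all_fun_ports_def port_value_node_slice)
  have r_port: "port_value (res_dim G d) (?v d) i = port_value (case_prod (res_dim G)) r (d, i)"
    if "(d, i) \<in> all_res_ports G" for d i
    using that by (simp add: res_index_def all_res_ports_def port_value_node_slice)
  have x: "restrict f (system_fun_index G) \<in> system_fun_space G"
    using joint_feasible_ports(1)[OF G fr] free_ports_subset(1)[of G]
    by (auto simp: system_fun_space_def prod_poset_def system_fun_index_def port_value_restrict
        euclid_def)
  have y: "restrict r (system_res_index G) \<in> system_res_space G"
    using joint_feasible_ports(2)[OF G fr] free_ports_subset(2)[of G]
    by (auto simp: system_res_space_def prod_poset_def system_res_index_def port_value_restrict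
        euclid_def)
  have edges: "\<forall>((d1, i1), (d2, j2))\<in>edges G.
      port_value (res_dim G d1) (?v d1) i1 \<le> port_value (fun_dim G d2) (?u d2) j2"
  proof (clarify)
    fix d1 i1 d2 j2 assume E: "((d1, i1), (d2, j2)) \<in> edges G"
    have "port_value (case_prod (res_dim G)) r (d1, i1) \<le> port_value (case_prod (fun_dim G)) f (d2, j2)"
      using fr E lcdp_edge(5)[OF G E] by (subst port_value_edge_le_iff) (auto simp: joint_feasible_def)
    then show "port_value (res_dim G d1) (?v d1) i1 \<le> port_value (fun_dim G d2) (?u d2) j2"
      using lcdp_edge[OF G E] f_port[of d2 j2] r_port[of d1 i1]
      by (simp add: all_fun_ports_def all_res_ports_def)
  qed
  have nodes: "\<forall>d\<in>nodes G. (?u d, ?v d) \<in> feasible G d"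
    using fr by (simp add: joint_feasible_def)
  have free_fun: "\<forall>(d, i)\<in>free_fun_ports G. port_value (fun_dim G d) (?u d) i
      = port_value (case_prod (fun_dim G)) (restrict f (system_fun_index G)) (d, i)"
    using free_ports_subset(1)[of G] f_port
    by (auto simp: system_fun_index_def port_value_restrict)
  have free_res: "\<forall>(d, i)\<in>free_res_ports G. port_value (res_dim G d) (?v d) i
      = port_value (case_prod (res_dim G)) (restrict r (system_res_index G)) (d, i)"
    using free_ports_subset(2)[of G] r_port
    by (auto simp: system_res_index_def port_value_restrict)
  show "p \<in> ldp_tot G"
    unfolding p ldp_tot_def
    by (intro CollectI case_prodI conjI exI[of _ ?u] exI[of _ ?v])
      (rule x y free_fun free_res nodes edges)+
qed

section \<open>The composite is a design problem\<close>

text \<open>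
  A product poset constrains its ports one by one, so replacing the values of some ports
  by other admissible values cannot leave it.
\<close>

lemma override_free_ports_in:
  assumes "\<And>d i. (d, i) \<in> A \<Longrightarrow> port_value (case_prod n) x (d, i) \<in> P d i"
    "\<And>i. i < m d \<Longrightarrow> port_value (case_prod n) f (d, i) \<in> P d i"
  shows "node_slice (prod_index {..<m d} (n d)) d
           (\<lambda>c. if c \<in> prod_index A (case_prod n) then x c else f c)
         \<in> prod_poset {..<m d} (n d) (P d)"
  unfolding node_slice_in_prod_poset_iff
proof (intro allI impI)
  fix i assume i: "i < m d"
  have "port_value (case_prod n) (\<lambda>c. if c \<in> prod_index A (case_prod n) then x c else f c) (d, i)
      = port_value (case_prod n) (if (d, i) \<in> A then x else f) (d, i)"
    by (auto simp: port_value_def prod_index_def)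
  then show "port_value (case_prod n)
      (\<lambda>c. if c \<in> prod_index A (case_prod n) then x c else f c) (d, i) \<in> P d i"
    using assms i by auto
qed

text \<open>
  The new system-level values are written over the unconnected ports of a feasible assignment. At
  each node the functionalities decrease and the resources increase, so the node stays feasible; the
  ports on edges are untouched, so the edge inequalities persist.
\<close>

lemma design_problem_ldp_tot:
  assumes G: "lcdp G"
  shows "design_problem (system_fun_space G) (system_res_space G) (ldp_tot G)"
  unfolding design_problem_def
proof (intro conjI allI impI, goal_cases)
  case 1
  then show ?case by (auto simp: ldp_tot_def)
next
  case (2 x y x' y')
  then have le: "x' \<le> x" "y \<le> y'" and x': "x' \<in> system_fun_space G" and y': "y' \<in> system_res_space G"
    by auto
  obtain f r where fr: "(f, r) \<in> joint_feasible G"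
    and x: "x = restrict f (system_fun_index G)" and y: "y = restrict r (system_res_index G)"
    using 2 unfolding ldp_tot_eq_restrict_joint_feasible[OF G] by auto
  define f' where "f' = (\<lambda>c. if c \<in> system_fun_index G then x' c else f c)"
  define r' where "r' = (\<lambda>c. if c \<in> system_res_index G then y' c else r c)"
  have f'_le: "f' c \<le> f c" for c
    using le_funD[OF le(1), of c] by (simp add: f'_def x split: if_splits)
  have r'_ge: "r c \<le> r' c" for c
    using le_funD[OF le(2), of c] by (simp add: r'_def y split: if_splits)
  have "(node_slice (fun_index G d) d f', node_slice (res_index G d) d r') \<in> feasible G d"
    if d: "d \<in> nodes G" for d
  proof -
    have "node_slice (fun_index G d) d f' \<in> fun_space G d"
      unfolding fun_index_def fun_space_def f'_def system_fun_index_def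
      using x' joint_feasible_ports(1)[OF G fr] d
      by (intro override_free_ports_in) (auto simp: system_fun_space_def prod_poset_def all_fun_ports_def)
    moreover have "node_slice (res_index G d) d r' \<in> res_space G d"
      unfolding res_index_def res_space_def r'_def system_res_index_def
      using y' joint_feasible_ports(2)[OF G fr] d
      by (intro override_free_ports_in) (auto simp: system_res_space_def prod_poset_def all_res_ports_def)
    moreover have "node_slice (fun_index G d) d f' \<le> node_slice (fun_index G d) d f"
      "node_slice (res_index G d) d r \<le> node_slice (res_index G d) d r'"
      using f'_le r'_ge by (auto simp: node_slice_def le_fun_def)
    moreover have "(node_slice (fun_index G d) d f, node_slice (res_index G d) d r) \<in> feasible G d"
      using fr d by (simp add: joint_feasible_def)
    ultimately show ?thesis
      using lcdp_node(1)[OF G d] unfolding linear_design_problem_def design_problem_def by blast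
  qed
  moreover have "r' (p, j) \<le> f' (q, j)"
    if pq: "(p, q) \<in> edges G" "j < case_prod (fun_dim G) q" for p q j
  proof -
    have "p \<notin> free_res_ports G" "q \<notin> free_fun_ports G"
      using pq by (force simp: free_res_ports_def free_fun_ports_def)+
    then have "r' (p, j) = r (p, j)" "f' (q, j) = f (q, j)"
      by (simp_all add: r'_def f'_def system_fun_index_def system_res_index_def prod_index_def)
    then show ?thesis
      using fr pq by (auto simp: joint_feasible_def)
  qed
  moreover have "f' \<in> euclid (all_fun_index G)" "r' \<in> euclid (all_res_index G)"
    using fr system_index_subset[of G]
    by (auto simp: f'_def r'_def joint_feasible_def euclid_def PiE_def extensional_def)
  ultimately have "(f', r') \<in> joint_feasible G"
    by (auto simp: joint_feasible_def)
  moreover have "x' = restrict f' (system_fun_index G)" "y' = restrict r' (system_res_index G)"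
    using x' y' by (auto simp: f'_def r'_def system_fun_space_def system_res_space_def prod_poset_def
        system_fun_index_def system_res_index_def euclid_def PiE_def extensional_def restrict_def)
  ultimately show ?case
    unfolding ldp_tot_eq_restrict_joint_feasible[OF G] by (force intro: rev_image_eqI)
qed

section \<open>The composite is a polyhedron\<close>

lemma euclid_Plus: "euclid (I <+> J) = (\<lambda>(x, y). case_sum x y) ` (euclid I \<times> euclid J)"
proof (intro set_eqI iffI)
  fix z :: "'a + 'b \<Rightarrow> real" assume "z \<in> euclid (I <+> J)"
  then have "(\<lambda>i. z (Inl i)) \<in> euclid I" "(\<lambda>j. z (Inr j)) \<in> euclid J"
    by (auto simp: euclid_def PiE_def extensional_def)
  moreover have "z = case_sum (\<lambda>i. z (Inl i)) (\<lambda>j. z (Inr j))"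
    by (rule ext) (simp split: sum.split)
  ultimately show "z \<in> (\<lambda>(x, y). case_sum x y) ` (euclid I \<times> euclid J)"
    by force
qed (auto simp: euclid_def PiE_def extensional_def split: sum.splits)

lemma restrict_case_sum:
  "restrict (case_sum f r) (I <+> J) = case_sum (restrict f I) (restrict r J)"
  by (rule ext) (auto split: sum.split)

lemma case_sum_image_mem_iff: "case_sum x y \<in> (\<lambda>(x, y). case_sum x y) ` S \<longleftrightarrow> (x, y) \<in> S"
proof
  assume "case_sum x y \<in> (\<lambda>(x, y). case_sum x y) ` S"
  then obtain x' y' where "(x', y') \<in> S" "case_sum x y = case_sum x' y'" by auto
  then show "(x, y) \<in> S"
    by (metis case_sum_o_inj(1) case_sum_o_inj(2))
qed force

lemma polyhedron_pair_in_joint_feasible: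
  assumes G: "lcdp G"
  shows "polyhedron_pair_in (all_fun_index G) (all_res_index G) (joint_feasible G)"
proof -
  let ?K = "all_fun_index G <+> all_res_index G"
  let ?g = "\<lambda>d c. map_sum (\<lambda>(i, j). ((d, i), j)) (\<lambda>(i, j). ((d, i), j)) c"
  let ?S = "\<lambda>d. (\<lambda>(x, y). case_sum x y) ` feasible G d"
  have K: "finite ?K"
    using finite_all_index[OF G] by simp
  have node: "polyhedron_in ?K {w \<in> euclid ?K.
      (\<lambda>c\<in>fun_index G d <+> res_index G d. w (?g d c)) \<in> ?S d}" if d: "d \<in> nodes G" for d
  proof (rule polyhedron_in_coordinate_preimage[OF _ K])
    show "finite (fun_index G d <+> res_index G d)"
      by (simp add: fun_index_def res_index_def prod_index_def)
    show "?g d ` (fun_index G d <+> res_index G d) \<subseteq> ?K"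
      using d by (auto simp: fun_index_def res_index_def prod_index_def all_fun_index_def
          all_res_index_def all_fun_ports_def all_res_ports_def)
    show "polyhedron_in (fun_index G d <+> res_index G d) (?S d)"
      using lcdp_node(1)[OF G d] by (simp add: linear_design_problem_def polyhedron_pair_in_def)
  qed
  have edge: "polyhedron_in ?K {w \<in> euclid ?K.
      \<forall>j\<in>{..<case_prod (fun_dim G) (snd e)}. w (Inr (fst e, j)) \<le> w (Inl (snd e, j))}"
    if e: "e \<in> edges G" for e
  proof (rule polyhedron_in_Ball, simp, rule polyhedron_in_coordinate_le[OF K])
    fix j assume "j \<in> {..<case_prod (fun_dim G) (snd e)}"
    then show "Inr (fst e, j) \<in> ?K" "Inl (snd e, j) \<in> ?K"
      using e lcdp_edge[OF G]
      by (cases e; force simp: all_fun_index_def all_res_index_def all_fun_ports_def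
          all_res_ports_def prod_index_def)+
  qed
  have slice: "(\<lambda>c\<in>fun_index G d <+> res_index G d. case_sum f r (?g d c)) \<in> ?S d \<longleftrightarrow>
      (node_slice (fun_index G d) d f, node_slice (res_index G d) d r) \<in> feasible G d" for d f r
  proof -
    have "(\<lambda>c\<in>fun_index G d <+> res_index G d. case_sum f r (?g d c))
        = case_sum (node_slice (fun_index G d) d f) (node_slice (res_index G d) d r)"
      by (rule ext) (auto simp: node_slice_def split: sum.split)
    then show ?thesis by (simp only: case_sum_image_mem_iff)
  qed
  have eq: "(\<lambda>(x, y). case_sum x y) ` joint_feasible G =
      {w \<in> euclid ?K. \<forall>d\<in>nodes G. (\<lambda>c\<in>fun_index G d <+> res_index G d. w (?g d c)) \<in> ?S d} \<inter>
      {w \<in> euclid ?K. \<forall>e\<in>edges G. \<forall>j\<in>{..<case_prod (fun_dim G) (snd e)}.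
         w (Inr (fst e, j)) \<le> w (Inl (snd e, j))}" (is "?A = ?B")
  proof -
    have sub: "?A \<subseteq> euclid ?K" "?B \<subseteq> euclid ?K"
      unfolding euclid_Plus by (auto simp: joint_feasible_def)
    have case_sum_mem: "case_sum f r \<in> ?A \<longleftrightarrow> case_sum f r \<in> ?B"
      if fr: "f \<in> euclid (all_fun_index G)" "r \<in> euclid (all_res_index G)" for f r
    proof -
      have "case_sum f r \<in> ?A \<longleftrightarrow> (f, r) \<in> joint_feasible G"
        by (rule case_sum_image_mem_iff)
      also have "\<dots> \<longleftrightarrow> (\<forall>d\<in>nodes G.
            (node_slice (fun_index G d) d f, node_slice (res_index G d) d r) \<in> feasible G d) \<and>
          (\<forall>e\<in>edges G. \<forall>j\<in>{..<case_prod (fun_dim G) (snd e)}.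
             case_sum f r (Inr (fst e, j)) \<le> case_sum f r (Inl (snd e, j)))"
        using fr by (simp add: joint_feasible_def case_prod_beta Ball_def)
      also have "\<dots> \<longleftrightarrow> case_sum f r \<in> ?B"
      proof -
        have "case_sum f r \<in> euclid ?K"
          using fr unfolding euclid_Plus by force
        then show ?thesis
          by (simp only: slice Int_iff mem_Collect_eq simp_thms)
      qed
      finally show ?thesis .
    qed
    show ?thesis
    proof (intro set_eqI)
      fix w show "w \<in> ?A \<longleftrightarrow> w \<in> ?B"
      proof (cases "w \<in> euclid ?K")
        case True
        then obtain f r where "w = case_sum f r" "f \<in> euclid (all_fun_index G)" "r \<in> euclid (all_res_index G)"
          unfolding euclid_Plus by auto
        then show ?thesis using case_sum_mem by (simp only:)
      next
        case False
        then show ?thesis using sub by blast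
      qed
    qed
  qed
  have fin: "finite (nodes G)" "finite (edges G)"
    using G by (auto simp: lcdp_def)
  have "polyhedron_in ?K ((\<lambda>(x, y). case_sum x y) ` joint_feasible G)"
    unfolding eq
    by (intro polyhedron_in_Int)
      (rule polyhedron_in_Ball[OF fin(1) node], assumption,
       rule polyhedron_in_Ball[OF fin(2) edge], assumption)
  then show ?thesis
    by (auto simp: polyhedron_pair_in_def joint_feasible_def)
qed

text \<open>
  Under the identification of pairs with points indexed by a disjoint sum, restricting both
  components is a single projection.
\<close>

lemma polyhedron_pair_in_projection:
  assumes "finite I" "finite J" "I' \<subseteq> I" "J' \<subseteq> J" "polyhedron_pair_in I J S"
  shows "polyhedron_pair_in I' J' ((\<lambda>(f, r). (restrict f I', restrict r J')) ` S)"
proof -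
  have "polyhedron_in (I' <+> J') ((\<lambda>w. restrict w (I' <+> J')) ` (\<lambda>(x, y). case_sum x y) ` S)"
    using assms by (intro polyhedron_in_projection[of "I <+> J"]) (auto simp: polyhedron_pair_in_def)
  moreover have "(\<lambda>w. restrict w (I' <+> J')) ` (\<lambda>(x, y). case_sum x y) ` S
      = (\<lambda>(x, y). case_sum x y) ` (\<lambda>(f, r). (restrict f I', restrict r J')) ` S"
    by (simp add: image_image restrict_case_sum case_prod_beta)
  ultimately show ?thesis
    by (auto simp: polyhedron_pair_in_def euclid_def)
qed

theorem theorem3:
  fixes G :: "'v codesign"
  assumes "lcdp G"
  shows "linear_design_problem
           (system_fun_index G) (system_fun_space G)
           (system_res_index G) (system_res_space G) (ldp_tot G)
         \<and> polyhedron_pair_in (system_fun_index G) (system_res_index G) (ldp_tot G)"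
proof -
  have polyhedron: "polyhedron_pair_in (system_fun_index G) (system_res_index G) (ldp_tot G)"
    unfolding ldp_tot_eq_restrict_joint_feasible[OF assms]
    using finite_all_index[OF assms] system_index_subset polyhedron_pair_in_joint_feasible[OF assms]
    by (intro polyhedron_pair_in_projection)
  have "finite (all_fun_ports G)" "finite (all_res_ports G)"
    using assms by (auto simp: lcdp_def all_fun_ports_def all_res_ports_def)
  then have "finite (free_fun_ports G)" "finite (free_res_ports G)"
    using free_ports_subset[of G] by (auto intro: finite_subset)
  then have "euclid_subposet (system_fun_index G) (system_fun_space G)"
    "euclid_subposet (system_res_index G) (system_res_space G)"
    unfolding system_fun_index_def system_fun_space_def system_res_index_def system_res_space_def
    using free_ports_subset[of G] lcdp_node(2,3)[OF assms]
    by (force simp: all_fun_ports_def all_res_ports_def intro!: euclid_subposet_prod_poset)+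
  then show ?thesis
    using polyhedron design_problem_ldp_tot[OF assms] by (simp add: linear_design_problem_def)
qed

end
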